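(* In the single-pass random order model with convex and $L$-smooth losses $(f_k)_{k\in[T]}$ on $\mathscr X$ whose gradients on $\mathscr X$ are bounded in norm by $G$, OFTRL with $M_t=g_{t-1}$ ($M_1=0$), $\eta_t=D^2/(\nu+\sum_{s=1}^{t-1}\eta_s\|g_s-M_s\|^2)$ and $\nu=LD^2+DG$ satisfies for every $u\in\mathscr X$ $$\mathbb E[R_T(u)]\le O\left(D\,\sigma_1\sqrt{\log\Big(e\,\frac{\widetilde\sigma_1}{\sigma_1}\Big)\,T}+LD^2+DG\right),$$ where $O(\cdot)$ hides a universal constant and $$\sigma_1^2=\max_{x\in\mathscr X}\frac1T\sum_{t=1}^T\Big\|\nabla f_t(x)-\frac1T\sum_{s=1}^T\nabla f_s(x)\Big\|^2,\qquad \widetilde\sigma_1^2=\frac1T\sum_{t=1}^T\max_{x\in\mathscr X}\Big\|\nabla f_t(x)-\frac1T\sum_{s=1}^T\nabla f_s(x)\Big\|^2$$ (if $\sigma_1=0$ the first term is read as $0$).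
   Context: Setting. $\mathscr X\subset\mathbb R^d$ is a closed bounded convex set, $\|\cdot\|$ is the Euclidean norm, and $D>0$ satisfies $\|x-y\|\le D$ and $\|x\|\le D$ for all $x,y\in\mathscr X$. $L$-smooth means that the gradient is $L$-Lipschitz on $\mathscr X$. Single-pass random order model (ROM): a family of $T$ losses $f_1,\dots,f_T:\mathscr X\to\mathbb R$ is fixed. In each round $t=1,\dots,T$ the learner chooses $x_t\in\mathscr X$ based on the past, then an index $\xi_t$ is drawn uniformly at random from the not-yet-used indices $[T]\setminus\{\xi_1,\dots,\xi_{t-1}\}$ (sampling without replacement), the loss function $f_{\xi_t}$ is revealed, and the learner suffers loss $f_{\xi_t}(x_t)$. OFTRL: with $g_t=\nabla f_{\xi_t}(x_t)$, $$x_t=\operatorname*{argmin}_{x\in\mathscr X}\Big\{\Big\langle x,\,M_t+\sum_{s=1}^{t-1}g_s\Big\rangle+\frac{\|x\|^2}{\eta_t}\Big\}.$$ Regret: $R_T(u)=\sum_{t=1}^T\langle g_t,x_t-u\rangle$ for $u\in\mathscr X$; $\mathbb E$ is the expectation over the random order. *)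

theory Defs
  imports "HOL-Probability.Probability" "HOL-Library.Poly_Mapping"
begin

subsection \<open>Euclidean spaces of all dimensions inside one type\<close>

text \<open>
  A universal constant has to be chosen before the dimension \<open>d\<close>, which is impossible if \<open>d\<close> is
  carried by a type. Hence every \<open>\<real>\<^sup>d\<close> is realised inside the type of finitely supported
  sequences, as the set of those that vanish from index \<open>d\<close> on. The instance below provides the
  Euclidean inner product, norm and metric.
\<close>

instantiation poly_mapping :: (type, real_vector) real_vector
begin

lift_definition scaleR_poly_mapping :: "real \<Rightarrow> ('a \<Rightarrow>\<^sub>0 'b) \<Rightarrow> 'a \<Rightarrow>\<^sub>0 'b"
  is "\<lambda>r f k. r *\<^sub>R f k"
  by (erule rev_finite_subset) auto

instance
  by standard (transfer; simp add: fun_eq_iff scaleR_add_left scaleR_add_right)+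

end

lemma lookup_scaleR: "Poly_Mapping.lookup (r *\<^sub>R x) k = r *\<^sub>R Poly_Mapping.lookup x k"
  by transfer simp

instantiation poly_mapping :: (type, real_inner) real_inner
begin

definition inner_poly_mapping :: "('a \<Rightarrow>\<^sub>0 'b) \<Rightarrow> ('a \<Rightarrow>\<^sub>0 'b) \<Rightarrow> real" where
  "inner x y = (\<Sum>k\<in>Poly_Mapping.keys x. Poly_Mapping.lookup x k \<bullet> Poly_Mapping.lookup y k)"

definition norm_poly_mapping :: "('a \<Rightarrow>\<^sub>0 'b) \<Rightarrow> real" where
  "norm x = sqrt (inner x x)" for x :: "'a \<Rightarrow>\<^sub>0 'b"

definition sgn_poly_mapping :: "('a \<Rightarrow>\<^sub>0 'b) \<Rightarrow> 'a \<Rightarrow>\<^sub>0 'b" where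
  "sgn x = x /\<^sub>R norm x" for x :: "'a \<Rightarrow>\<^sub>0 'b"

definition dist_poly_mapping :: "('a \<Rightarrow>\<^sub>0 'b) \<Rightarrow> ('a \<Rightarrow>\<^sub>0 'b) \<Rightarrow> real" where
  "dist x y = norm (x - y)" for x y :: "'a \<Rightarrow>\<^sub>0 'b"

definition uniformity_poly_mapping :: "(('a \<Rightarrow>\<^sub>0 'b) \<times> ('a \<Rightarrow>\<^sub>0 'b)) filter" where
  "uniformity = (INF e\<in>{0 <..}. principal {(x :: 'a \<Rightarrow>\<^sub>0 'b, y). dist x y < e})"

definition open_poly_mapping :: "('a \<Rightarrow>\<^sub>0 'b) set \<Rightarrow> bool" where
  "open U \<longleftrightarrow> (\<forall>x\<in>U. eventually (\<lambda>(x', y). x' = x \<longrightarrow> y \<in> U) uniformity)"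
  for U :: "('a \<Rightarrow>\<^sub>0 'b) set"

lemma inner_poly_mapping_superset:
  fixes x y :: "'a \<Rightarrow>\<^sub>0 'b"
  assumes "finite K" "Poly_Mapping.keys x \<subseteq> K"
  shows "inner x y = (\<Sum>k\<in>K. Poly_Mapping.lookup x k \<bullet> Poly_Mapping.lookup y k)"
  unfolding inner_poly_mapping_def using assms
  by (intro sum.mono_neutral_left) (auto simp: in_keys_iff)

instance
proof
  fix x y z :: "'a \<Rightarrow>\<^sub>0 'b" and r :: real
  let ?K = "Poly_Mapping.keys x \<union> Poly_Mapping.keys y \<union> Poly_Mapping.keys (x + y)
    \<union> Poly_Mapping.keys (r *\<^sub>R x)"
  have K: "finite ?K" by simp
  show "inner x y = inner y x"
    by (subst (1 2) inner_poly_mapping_superset[OF K]) (auto simp: inner_commute)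
  show "inner (x + y) z = inner x z + inner y z"
    by (subst (1 2 3) inner_poly_mapping_superset[OF K])
       (auto simp: lookup_add inner_add_left sum.distrib)
  show "inner (r *\<^sub>R x) y = r * inner x y"
    by (subst (1 2) inner_poly_mapping_superset[OF K])
       (auto simp: lookup_scaleR sum_distrib_left)
  show "0 \<le> inner x x"
    by (auto simp: inner_poly_mapping_def intro: sum_nonneg)
  show "inner x x = 0 \<longleftrightarrow> x = 0"
    unfolding inner_poly_mapping_def
    by (subst sum_nonneg_eq_0_iff) (auto simp: in_keys_iff intro: poly_mapping_eqI)
  show "norm x = sqrt (inner x x)" "sgn x = x /\<^sub>R norm x" "dist x y = norm (x - y)"
    by (rule norm_poly_mapping_def sgn_poly_mapping_def dist_poly_mapping_def)+
  show "uniformity = (INF e\<in>{0 <..}. principal {(x :: 'a \<Rightarrow>\<^sub>0 'b, y). dist x y < e})"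
    by (rule uniformity_poly_mapping_def)
  show "open U \<longleftrightarrow> (\<forall>x\<in>U. eventually (\<lambda>(x', y). x' = x \<longrightarrow> y \<in> U) uniformity)"
    for U :: "('a \<Rightarrow>\<^sub>0 'b) set"
    by (rule open_poly_mapping_def)
qed

end

definition Rd :: "nat \<Rightarrow> (nat \<Rightarrow>\<^sub>0 real) set" where
  "Rd d = {x. Poly_Mapping.keys x \<subseteq> {..<d}}"


subsection \<open>Losses\<close>

text \<open>
  The losses live on \<open>X\<close> only, so derivatives are taken within \<open>X\<close>. If \<open>X\<close> has empty interior,
  such a gradient need not be unique; \<open>grad\<close> is then any fixed choice.
\<close>

definition has_gradient_on ::
  "('a::real_inner \<Rightarrow> real) \<Rightarrow> ('a \<Rightarrow> 'a) \<Rightarrow> 'a set \<Rightarrow> bool" where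
  "has_gradient_on f grad X \<longleftrightarrow>
     (\<forall>x\<in>X. (f has_derivative (\<lambda>h. grad x \<bullet> h)) (at x within X))"

definition mean_gradient :: "nat \<Rightarrow> (nat \<Rightarrow> 'a::real_inner \<Rightarrow> 'a) \<Rightarrow> 'a \<Rightarrow> 'a" where
  "mean_gradient T grad x = (1 / real T) *\<^sub>R (\<Sum>s\<in>{1..T}. grad s x)"

text \<open>
  The suprema below are maxima whenever \<open>X\<close> is compact and nonempty and the gradients are
  continuous on \<open>X\<close>.
\<close>

definition sigma1 :: "'a set \<Rightarrow> nat \<Rightarrow> (nat \<Rightarrow> 'a::real_inner \<Rightarrow> 'a) \<Rightarrow> real" where
  "sigma1 X T grad =
     sqrt (SUP x\<in>X. (1 / real T) * (\<Sum>t\<in>{1..T}. (norm (grad t x - mean_gradient T grad x))\<^sup>2))"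

definition sigma1_tilde :: "'a set \<Rightarrow> nat \<Rightarrow> (nat \<Rightarrow> 'a::real_inner \<Rightarrow> 'a) \<Rightarrow> real" where
  "sigma1_tilde X T grad =
     sqrt ((1 / real T) * (\<Sum>t\<in>{1..T}. SUP x\<in>X. (norm (grad t x - mean_gradient T grad x))\<^sup>2))"


subsection \<open>Single-pass random order model\<close>

primrec draw_without_replacement :: "nat \<Rightarrow> nat \<Rightarrow> nat list pmf" where
  "draw_without_replacement T 0 = return_pmf []"
| "draw_without_replacement T (Suc n) =
     bind_pmf (draw_without_replacement T n)
       (\<lambda>\<xi>. map_pmf (\<lambda>k. \<xi> @ [k]) (pmf_of_set ({1..T} - set \<xi>)))"

definition random_order :: "nat \<Rightarrow> nat list pmf" where
  "random_order T = draw_without_replacement T T"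

text \<open>
  A learner \<open>A\<close> maps the list of indices revealed so far to the next decision. Rounds are numbered
  from 1, whereas lists are indexed from 0.
\<close>

definition decision :: "(nat list \<Rightarrow> 'a) \<Rightarrow> nat list \<Rightarrow> nat \<Rightarrow> 'a" where
  "decision A \<xi> t = A (take (t - 1) \<xi>)"

definition observed_gradient ::
  "(nat \<Rightarrow> 'a \<Rightarrow> 'a) \<Rightarrow> (nat list \<Rightarrow> 'a) \<Rightarrow> nat list \<Rightarrow> nat \<Rightarrow> 'a" where
  "observed_gradient grad A \<xi> t = grad (\<xi> ! (t - 1)) (decision A \<xi> t)"

definition regret :: "nat \<Rightarrow> (nat \<Rightarrow> 'a::real_inner) \<Rightarrow> (nat \<Rightarrow> 'a) \<Rightarrow> 'a \<Rightarrow> real" where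
  "regret T g x u = (\<Sum>t\<in>{1..T}. g t \<bullet> (x t - u))"


subsection \<open>Optimistic follow the regularized leader\<close>

definition oftrl_run ::
  "'a::real_inner set \<Rightarrow> nat \<Rightarrow> (nat \<Rightarrow> 'a) \<Rightarrow> (nat \<Rightarrow> real) \<Rightarrow> (nat \<Rightarrow> 'a) \<Rightarrow> (nat \<Rightarrow> 'a) \<Rightarrow> bool"
where
  "oftrl_run X T M \<eta> g x \<longleftrightarrow>
     (\<forall>t\<in>{1..T}. is_arg_min
        (\<lambda>y. y \<bullet> (M t + (\<Sum>s\<in>{1..<t}. g s)) + (norm y)\<^sup>2 / \<eta> t) (\<lambda>y. y \<in> X) (x t))"

definition last_gradient :: "(nat \<Rightarrow> 'a::zero) \<Rightarrow> nat \<Rightarrow> 'a" where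
  "last_gradient g t = (if t = 1 then 0 else g (t - 1))"

text \<open>
  If \<open>\<nu> = 0\<close> (which below happens only if all gradients vanish on \<open>X\<close>), the intended first step size
  is infinite. Division by zero then makes it 0, and the regularizer of \<open>oftrl_run\<close> vanishes, as it
  should.
\<close>

fun adaptive_step ::
  "real \<Rightarrow> real \<Rightarrow> (nat \<Rightarrow> 'a::real_normed_vector) \<Rightarrow> (nat \<Rightarrow> 'a) \<Rightarrow> nat \<Rightarrow> real" where
  "adaptive_step D \<nu> M g t =
     D\<^sup>2 / (\<nu> + (\<Sum>s\<in>{1..<t}. adaptive_step D \<nu> M g s * (norm (g s - M s))\<^sup>2))"

declare adaptive_step.simps [simp del]

definition oftrl_learner ::
  "'a::real_inner set \<Rightarrow> nat \<Rightarrow> real \<Rightarrow> real \<Rightarrow> (nat \<Rightarrow> 'a \<Rightarrow> 'a) \<Rightarrow> (nat list \<Rightarrow> 'a) \<Rightarrow> bool" where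
  "oftrl_learner X T D \<nu> grad A \<longleftrightarrow>
     (\<forall>\<xi>\<in>set_pmf (random_order T).
        let g = observed_gradient grad A \<xi>; M = last_gradient g
        in oftrl_run X T M (adaptive_step D \<nu> M g) g (decision A \<xi>))"

end

theory Submission
  imports Defs
begin

text \<open>
  Write \<open>h\<^sub>k(x)\<close> for the squared deviation of \<open>\<nabla>f\<^sub>k(x)\<close> from the mean gradient and \<open>H\<close> for the sum of
  \<open>h\<^sub>k(x\<^sub>t)\<close> over the rounds, with \<open>k = \<xi>\<^sub>t\<close>. For every order, the regret is at most
  \<open>9 D sqrt H + 30 (L D\<^sup>2 + D G)\<close>: the step sizes give a bound by the square root of the sum of
  \<open>\<parallel>g\<^sub>t - M\<^sub>t\<parallel>\<^sup>2\<close>, and by smoothness \<open>g\<^sub>t - M\<^sub>t\<close> consists of two deviations and a term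
  \<open>L \<parallel>x\<^sub>t - x\<^sub>t\<^sub>-\<^sub>1\<parallel>\<close>, which the negative terms from strong convexity absorb because \<open>1 / \<eta>\<^sub>t \<ge> L\<close>.

  If \<open>m\<close> indices are still unused, the conditional expectation of the next term of \<open>H\<close> is at most
  \<open>T \<sigma>\<^sub>1\<^sup>2 / m\<close>. As every \<open>\<xi>\<^sub>t\<close> is uniform, its expectation is also at most the square of the second
  variance \<open>\<sigma>\<close>-tilde. Summing the minimum of the two bounds over \<open>m\<close> gives the logarithm of the ratio
  of the two, and Jensen's inequality concludes.
\<close>

section \<open>Regret of OFTRL for a fixed gradient sequence\<close>

text \<open>The objective is exactly quadratic on the segment from \<open>x\<close> to
  \<open>y\<close>. Minimality against the point with parameter \<open>l\<close>, divided by
  \<open>l\<close>, gives the claim with an extra factor \<open>1 - l\<close>, and then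
  \<open>l\<close> tends to 0.\<close>

lemma arg_min_quadratic_growth:
  fixes x y v :: "'a::real_inner"
  assumes "convex X" and min: "is_arg_min (\<lambda>y. y \<bullet> v + c * (norm y)\<^sup>2) (\<lambda>y. y \<in> X) x" and "y \<in> X"
  shows "x \<bullet> v + c * (norm x)\<^sup>2 + c * (norm (y - x))\<^sup>2 \<le> y \<bullet> v + c * (norm y)\<^sup>2"
proof -
  define F where "F = (\<lambda>y. y \<bullet> v + c * (norm y)\<^sup>2)"
  have x: "x \<in> X" and Fx: "\<And>z. z \<in> X \<Longrightarrow> F x \<le> F z"
    using min by (auto simp: is_arg_min_linorder F_def)
  have "c * (1 - l) * (norm (y - x))\<^sup>2 \<le> F y - F x" if l: "0 < l" "l < 1" for l
  proof -
    have "(1 - l) *\<^sub>R x + l *\<^sub>R y \<in> X"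
      using assms x l by (intro convexD) auto
    then have "F x \<le> F ((1 - l) *\<^sub>R x + l *\<^sub>R y)" by (rule Fx)
    also have "\<dots> = F x + l * (F y - F x - c * (1 - l) * (norm (y - x))\<^sup>2)"
      unfolding F_def power2_norm_eq_inner
      by (simp add: inner_add_left inner_add_right inner_diff_left inner_diff_right inner_commute)
         (simp add: algebra_simps)
    finally have "0 \<le> l * (F y - F x - c * (1 - l) * (norm (y - x))\<^sup>2)" by simp
    with l show ?thesis by (simp add: zero_le_mult_iff)
  qed
  then have "eventually (\<lambda>l. c * (1 - l) * (norm (y - x))\<^sup>2 \<le> F y - F x) (at_right 0)"
    by (auto simp: eventually_at_right_field intro!: exI[of _ 1])
  moreover have "((\<lambda>l. c * (1 - l) * (norm (y - x))\<^sup>2) \<longlongrightarrow> c * (1 - 0) * (norm (y - x))\<^sup>2) (at_right 0)"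
    by (intro tendsto_intros)
  ultimately have "c * (1 - 0) * (norm (y - x))\<^sup>2 \<le> F y - F x"
    by (intro tendsto_upperbound[where F = "at_right 0"]) auto
  then show ?thesis by (simp add: F_def)
qed

text \<open>
  Comparing consecutive minimisers directly avoids the auxiliary iterates of the usual analysis, which
  would have to be shown to exist.
\<close>

lemma oftrl_regret:
  fixes x :: "nat \<Rightarrow> 'a::real_inner"
  assumes run: "oftrl_run X T M \<eta> g x" and "convex X" "u \<in> X" "T \<ge> 1"
    and pos: "\<And>t. \<eta> t > 0" and mono: "\<And>t. \<eta> (Suc t) \<le> \<eta> t"
  shows "regret T g x u \<le> (norm u)\<^sup>2 / \<eta> T + (g T - M T) \<bullet> (x T - u)
    + (\<Sum>t\<in>{1..<T}. (x t - x (Suc t)) \<bullet> (g t - M t) - (norm (x t - x (Suc t)))\<^sup>2 / \<eta> t)"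
proof -
  define V where "V n = M n + (\<Sum>s\<in>{1..<n}. g s)" for n
  define P where "P n y = y \<bullet> V n + (1 / \<eta> n) * (norm y)\<^sup>2" for n y
  have growth: "P n (x n) + (1 / \<eta> n) * (norm (y - x n))\<^sup>2 \<le> P n y" if "n \<in> {1..T}" "y \<in> X" for n y
    unfolding P_def using run that assms(2)
    by (intro arg_min_quadratic_growth[where X = X]) (auto simp: oftrl_run_def V_def field_simps)
  have X: "x n \<in> X" if "n \<in> {1..T}" for n
    using run that by (auto simp: oftrl_run_def is_arg_min_def)
  \<comment> \<open>In passing from \<open>n\<close> to \<open>Suc n\<close>, quadratic growth of
    \<open>P n\<close> is evaluated at \<open>x (Suc n)\<close>, while the regularizer only
    increases. Exchanging the hint \<open>M n\<close> for \<open>g n\<close> and the new hint is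
    what pairs the movement \<open>x n - x (Suc n)\<close> with \<open>g n - M n\<close>.\<close>
  have low: "x n \<bullet> M n + (\<Sum>t\<in>{1..<n}. x t \<bullet> g t - ((x t - x (Suc t)) \<bullet> (g t - M t)
      - (norm (x t - x (Suc t)))\<^sup>2 / \<eta> t)) \<le> P n (x n)" if "1 \<le> n" "n \<le> T" for n
    using that
  proof (induction n rule: nat_induct_at_least)
    case base
    then show ?case using pos[of 1] by (simp add: P_def V_def)
  next
    case (Suc n)
    have V: "V (Suc n) = V n + (g n + M (Suc n) - M n)"
      using Suc by (simp add: V_def)
    have "1 / \<eta> n \<le> 1 / \<eta> (Suc n)"
      using pos[of n] pos[of "Suc n"] mono[of n] by (simp add: frac_le)
    then have "(1 / \<eta> n) * (norm (x (Suc n)))\<^sup>2 \<le> (1 / \<eta> (Suc n)) * (norm (x (Suc n)))\<^sup>2"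
      by (intro mult_right_mono) auto
    then have "P n (x (Suc n)) + x (Suc n) \<bullet> (g n + M (Suc n) - M n) \<le> P (Suc n) (x (Suc n))"
      unfolding P_def V by (simp add: inner_add_right inner_diff_right)
    moreover have "P n (x n) + (norm (x n - x (Suc n)))\<^sup>2 / \<eta> n \<le> P n (x (Suc n))"
      using growth[of n "x (Suc n)"] X[of "Suc n"] Suc by (simp add: norm_minus_commute)
    ultimately show ?case using Suc
      by (simp add: inner_add_right inner_diff_right inner_diff_left inner_commute)
  qed
  \<comment> \<open>The last objective contains \<open>M T\<close> where the regret has
    \<open>g T\<close>; this mismatch becomes the boundary term
    \<open>(g T - M T) \<bullet> (x T - u)\<close>.\<close>
  have "P T (x T) \<le> P T u"
    using growth[of T u] assms pos[of T]
    by (smt (verit) atLeastAtMost_iff divide_nonneg_pos mult_nonneg_nonneg zero_le_power2 order_refl)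
  with low[of T] assms have "x T \<bullet> M T + (\<Sum>t\<in>{1..<T}. x t \<bullet> g t - ((x t - x (Suc t)) \<bullet> (g t - M t)
      - (norm (x t - x (Suc t)))\<^sup>2 / \<eta> t)) \<le> P T u" by simp
  moreover have "P T u = u \<bullet> M T + (\<Sum>t\<in>{1..<T}. u \<bullet> g t) + (norm u)\<^sup>2 / \<eta> T"
    by (simp add: P_def V_def inner_add_right inner_sum_right)
  moreover have "regret T g x u = (\<Sum>t\<in>{1..<T}. x t \<bullet> g t) - (\<Sum>t\<in>{1..<T}. u \<bullet> g t) + g T \<bullet> (x T - u)"
    using \<open>T \<ge> 1\<close>
    by (simp add: regret_def inner_diff_right inner_commute sum_subtractf sum.last_plus)
  moreover have "x T \<bullet> M T - u \<bullet> M T + g T \<bullet> (x T - u) - g T \<bullet> (x T - u)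
      = M T \<bullet> (x T - u)"
    by (simp add: inner_diff_right inner_commute)
  ultimately show ?thesis
    unfolding sum_subtractf inner_diff_left[of "g T"] by linarith
qed

section \<open>Adaptive step sizes\<close>

lemma adaptive_step_pos:
  assumes "D > 0" "\<nu> > 0"
  shows "adaptive_step D \<nu> M g t > 0"
proof (induction t rule: less_induct)
  case (less t)
  have "0 \<le> (\<Sum>s\<in>{1..<t}. adaptive_step D \<nu> M g s * (norm (g s - M s))\<^sup>2)"
    using less by (intro sum_nonneg mult_nonneg_nonneg) (auto intro: less_imp_le)
  then show ?case
    using assms by (subst adaptive_step.simps) (auto intro!: divide_pos_pos add_pos_nonneg)
qed

lemma adaptive_step_antimono:
  assumes "D > 0" "\<nu> > 0"
  shows "adaptive_step D \<nu> M g (Suc t) \<le> adaptive_step D \<nu> M g t"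
proof -
  let ?S = "\<lambda>n. \<Sum>s\<in>{1..<n}. adaptive_step D \<nu> M g s * (norm (g s - M s))\<^sup>2"
  have nonneg: "0 \<le> adaptive_step D \<nu> M g s * (norm (g s - M s))\<^sup>2" for s
    using adaptive_step_pos[OF assms, of M g s] by simp
  have "?S t \<le> ?S (Suc t)"
    using nonneg by (intro sum_mono2) auto
  moreover have "0 \<le> ?S t" using nonneg by (intro sum_nonneg) auto
  ultimately show ?thesis
    unfolding adaptive_step.simps[of D \<nu> M g t] adaptive_step.simps[of D \<nu> M g "Suc t"]
    using assms by (intro divide_left_mono) (auto intro!: mult_pos_pos add_pos_nonneg)
qed

text \<open>The square of the sum is controlled increment by increment: adding
  \<open>\<eta> a\<close> to \<open>S\<close> raises \<open>S^2\<close> by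
  \<open>a (2 \<eta> S + \<eta>^2 a)\<close>. The definition of the step gives
  \<open>\<eta> S \<le> D^2\<close>, and \<open>D * G \<le> \<nu>\<close> gives
  \<open>\<eta> G \<le> D\<close>, hence \<open>\<eta>^2 a \<le> 4 D^2\<close>; so 6 is 2 +
  4.\<close>

lemma adaptive_step_sum_bound:
  assumes "D > 0" "\<nu> > 0" "G \<ge> 0" "D * G \<le> \<nu>"
    and bound: "\<And>s. s \<in> {1..<n} \<Longrightarrow> norm (g s - M s) \<le> 2 * G"
  shows "(\<Sum>s\<in>{1..<n}. adaptive_step D \<nu> M g s * (norm (g s - M s))\<^sup>2)\<^sup>2
    \<le> 6 * D\<^sup>2 * (\<Sum>s\<in>{1..<n}. (norm (g s - M s))\<^sup>2)"
  using bound
proof (induction n)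
  case 0
  then show ?case by simp
next
  case (Suc n)
  let ?\<eta> = "adaptive_step D \<nu> M g" and ?a = "\<lambda>s. (norm (g s - M s))\<^sup>2"
  let ?S = "\<Sum>s\<in>{1..<n}. ?\<eta> s * ?a s"
  show ?case
  proof (cases "n = 0")
    case False
    have \<eta>: "?\<eta> n > 0" by (intro adaptive_step_pos assms)
    have S: "0 \<le> ?S"
      using adaptive_step_pos[OF assms(1,2), of M g]
      by (intro sum_nonneg mult_nonneg_nonneg) (auto intro: less_imp_le)
    have \<eta>_eq: "?\<eta> n * (\<nu> + ?S) = D\<^sup>2"
      using S assms by (subst adaptive_step.simps) auto
    have 1: "?\<eta> n * ?S \<le> D\<^sup>2"
      using \<eta>_eq \<eta> assms by (smt (verit) distrib_left mult_pos_pos)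
    have "D * (?\<eta> n * G) = ?\<eta> n * (D * G)" by simp
    also have "\<dots> \<le> ?\<eta> n * (\<nu> + ?S)" using S \<eta> assms by (intro mult_left_mono) auto
    finally have "?\<eta> n * G \<le> D" using \<eta>_eq assms by (simp add: power2_eq_square)
    moreover have "?\<eta> n * norm (g n - M n) \<le> ?\<eta> n * (2 * G)"
      using Suc.prems[of n] False \<eta> by (intro mult_left_mono) auto
    ultimately have "?\<eta> n * norm (g n - M n) \<le> 2 * D" by simp
    then have "(?\<eta> n * norm (g n - M n))\<^sup>2 \<le> (2 * D)\<^sup>2"
      using \<eta> by (intro power_mono) auto
    then have "?\<eta> n * (?\<eta> n * ?a n) \<le> 4 * D\<^sup>2"
      by (simp add: power2_eq_square algebra_simps)
    with 1 have "2 * (?\<eta> n * ?S) + ?\<eta> n * (?\<eta> n * ?a n) \<le> 6 * D\<^sup>2" by simp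
    then have "?a n * (2 * (?\<eta> n * ?S) + ?\<eta> n * (?\<eta> n * ?a n)) \<le> ?a n * (6 * D\<^sup>2)"
      by (intro mult_left_mono) auto
    moreover have "?S\<^sup>2 \<le> 6 * D\<^sup>2 * (\<Sum>s\<in>{1..<n}. ?a s)"
      using Suc by auto
    moreover have "(?S + ?\<eta> n * ?a n)\<^sup>2
        = ?S\<^sup>2 + ?a n * (2 * (?\<eta> n * ?S) + ?\<eta> n * (?\<eta> n * ?a n))"
      by (simp add: power2_eq_square algebra_simps)
    ultimately show ?thesis using False by (simp add: algebra_simps)
  qed simp
qed

section \<open>Gradient variation and the bound for a fixed order\<close>

lemma norm_add3_squared_le:
  fixes a b c :: "'a::real_normed_vector"
  shows "(norm (a + b + c))\<^sup>2 \<le> 3 * ((norm a)\<^sup>2 + (norm b)\<^sup>2 + (norm c)\<^sup>2)"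
proof -
  have "(norm (a + b + c))\<^sup>2 \<le> (norm a + norm b + norm c)\<^sup>2"
    by (intro power_mono norm_triangle_le add_right_mono norm_triangle_ineq) auto
  also have "\<dots> \<le> 3 * ((norm a)\<^sup>2 + (norm b)\<^sup>2 + (norm c)\<^sup>2)"
    using zero_le_power2[of "norm a - norm b"] zero_le_power2[of "norm a - norm c"]
      zero_le_power2[of "norm b - norm c"]
    by (simp add: power2_eq_square algebra_simps)
  finally show ?thesis .
qed

text \<open>The difference of consecutive gradients is split at \<open>m (x (Suc n))\<close> and
  \<open>m (x n)\<close>. Each deviation enters two differences with factor 3, whence 6; the last
  one has entered only one so far, and subtracting the surplus makes the induction close. The term
  \<open>G\<^sup>2\<close> pays for the first round, where the hint is 0.\<close>

lemma last_gradient_variation_le: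
  assumes "L-lipschitz_on X m" and x: "\<And>t. t \<in> {1..n} \<Longrightarrow> x t \<in> X"
    and "norm (g 1) \<le> G" "n \<ge> 1"
  shows "(\<Sum>t\<in>{1..n}. (norm (g t - last_gradient g t))\<^sup>2)
    \<le> G\<^sup>2 + 6 * (\<Sum>t\<in>{1..n}. (norm (g t - m (x t)))\<^sup>2) - 3 * (norm (g n - m (x n)))\<^sup>2
      + 3 * L\<^sup>2 * (\<Sum>t\<in>{1..<n}. (norm (x t - x (Suc t)))\<^sup>2)"
  using \<open>n \<ge> 1\<close> x
proof (induction n rule: nat_induct_at_least)
  case base
  have "(norm (g 1))\<^sup>2 \<le> G\<^sup>2" using assms by (intro power_mono) auto
  then show ?case by (simp add: last_gradient_def add_increasing)
next
  case (Suc n)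
  let ?h = "\<lambda>t. (norm (g t - m (x t)))\<^sup>2"
  have "norm (m (x (Suc n)) - m (x n)) \<le> L * norm (x (Suc n) - x n)"
    using lipschitz_onD[OF assms(1), of "x (Suc n)" "x n"] Suc by (simp add: dist_norm)
  then have "(norm (m (x (Suc n)) - m (x n)))\<^sup>2 \<le> (L * norm (x (Suc n) - x n))\<^sup>2"
    by (intro power_mono) auto
  moreover have "(norm (g (Suc n) - g n))\<^sup>2
      \<le> 3 * (?h (Suc n) + (norm (m (x (Suc n)) - m (x n)))\<^sup>2 + ?h n)"
    using norm_add3_squared_le[of "g (Suc n) - m (x (Suc n))" "m (x (Suc n)) - m (x n)" "m (x n) - g n"]
    by (simp add: norm_minus_commute[of "m (x n)" "g n"])
  ultimately have "(norm (g (Suc n) - g n))\<^sup>2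
      \<le> 3 * ?h (Suc n) + 3 * L\<^sup>2 * (norm (x n - x (Suc n)))\<^sup>2 + 3 * ?h n"
    by (simp add: power_mult_distrib norm_minus_commute[of "x n"])
  moreover have "last_gradient g (Suc n) = g n" using Suc by (simp add: last_gradient_def)
  ultimately show ?case using Suc by (simp add: algebra_simps)
qed

text \<open>No randomness enters: \<open>m\<close> is any \<open>L\<close>-Lipschitz field and will
  be the mean gradient. In the proof \<open>H\<close> collects squared deviations, \<open>Q\<close>
  squared movements, and \<open>S\<close> is the sum that defines the step sizes.\<close>

lemma oftrl_pathwise_regret:
  fixes x :: "nat \<Rightarrow> 'a::real_inner"
  assumes run: "oftrl_run X T (last_gradient g)
      (adaptive_step D (L * D\<^sup>2 + D * G) (last_gradient g) g) g x"
    and "convex X" "u \<in> X" "T \<ge> 1" "D > 0"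
    and diam: "\<And>y z. y \<in> X \<Longrightarrow> z \<in> X \<Longrightarrow> norm (y - z) \<le> D"
    and rad: "\<And>y. y \<in> X \<Longrightarrow> norm y \<le> D"
    and g: "\<And>t. t \<in> {1..T} \<Longrightarrow> norm (g t) \<le> G"
    and lip: "L-lipschitz_on X m"
  shows "regret T g x u \<le> 9 * D * sqrt (\<Sum>t\<in>{1..T}. (norm (g t - m (x t)))\<^sup>2)
    + 30 * (L * D\<^sup>2 + D * G)"
proof -
  define \<nu> where "\<nu> = L * D\<^sup>2 + D * G"
  define M where "M = last_gradient g"
  define \<eta> where "\<eta> = adaptive_step D \<nu> M g"
  define a where "a t = (norm (g t - M t))\<^sup>2" for t
  define \<Delta> where "\<Delta> t = norm (x t - x (Suc t))" for t
  define H where "H = (\<Sum>t\<in>{1..T}. (norm (g t - m (x t)))\<^sup>2)"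
  define Q where "Q = (\<Sum>t\<in>{1..<T}. (\<Delta> t)\<^sup>2)"
  define S where "S = (\<Sum>t\<in>{1..<T}. \<eta> t * a t)"
  have L: "L \<ge> 0" using lip by (simp add: lipschitz_on_def)
  have G: "G \<ge> 0" using order_trans[OF norm_ge_zero g[of 1]] \<open>T \<ge> 1\<close> by simp
  have H: "H \<ge> 0" unfolding H_def by (intro sum_nonneg) auto
  have Q: "Q \<ge> 0" unfolding Q_def by (intro sum_nonneg) auto
  have x: "x t \<in> X" if "t \<in> {1..T}" for t
    using run that by (auto simp: oftrl_run_def is_arg_min_def)
  have "regret T g x u \<le> 9 * D * sqrt H + 30 * \<nu>"
  proof (cases "\<nu> = 0")
    case True
    have "L * D\<^sup>2 \<ge> 0" "D * G \<ge> 0" using L G \<open>D > 0\<close> by auto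
    with True have "D * G = 0" unfolding \<nu>_def by linarith
    then have "g t = 0" if "t \<in> {1..T}" for t using g[OF that] \<open>D > 0\<close> by simp
    then have "regret T g x u = 0" by (simp add: regret_def)
    then show ?thesis using True H \<open>D > 0\<close> by simp
  next
    case False
    then have \<nu>: "\<nu> > 0" using L G \<open>D > 0\<close> unfolding \<nu>_def
      by (metis add_nonneg_nonneg less_eq_real_def mult_nonneg_nonneg zero_le_power2)
    note \<eta>_pos = adaptive_step_pos[OF \<open>D > 0\<close> \<nu>, of M g, folded \<eta>_def]
    have gM: "norm (g t - M t) \<le> 2 * G" if t: "t \<in> {1..T}" for t
    proof -
      have "norm (M t) \<le> G"
      proof (cases "t = 1")
        case False
        with t have "t - 1 \<in> {1..T}" by auto
        from g[OF this] False show ?thesis by (simp add: M_def last_gradient_def)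
      qed (use G in \<open>simp add: M_def last_gradient_def\<close>)
      then show ?thesis using g[OF t] norm_triangle_ineq4[of "g t" "M t"] by linarith
    qed
    have inv: "1 / \<eta> t = (\<nu> + (\<Sum>s\<in>{1..<t}. \<eta> s * a s)) / D\<^sup>2" for t
      unfolding \<eta>_def a_def by (subst adaptive_step.simps) simp
    \<comment> \<open>This is the purpose of the summand \<open>L * D\<^sup>2\<close> in
      \<open>\<nu>\<close>: every regularizer is at least as strong as the smoothness
      constant.\<close>
    have inv_ge: "L \<le> 1 / \<eta> t" for t
    proof -
      have "0 \<le> (\<Sum>s\<in>{1..<t}. \<eta> s * a s)"
        using \<eta>_pos by (intro sum_nonneg) (auto simp: a_def less_imp_le)
      then have "L * D\<^sup>2 \<le> \<nu> + (\<Sum>s\<in>{1..<t}. \<eta> s * a s)"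
        using G \<open>D > 0\<close> by (simp add: \<nu>_def)
      then show ?thesis using \<open>D > 0\<close> by (simp add: inv pos_le_divide_eq)
    qed
    have reg: "regret T g x u \<le> (norm u)\<^sup>2 / \<eta> T + (g T - M T) \<bullet> (x T - u)
        + (\<Sum>t\<in>{1..<T}. (x t - x (Suc t)) \<bullet> (g t - M t) - (\<Delta> t)\<^sup>2 / \<eta> t)"
      unfolding \<Delta>_def using run \<eta>_pos adaptive_step_antimono[OF \<open>D > 0\<close> \<nu>] assms(2-4)
      by (intro oftrl_regret[where X = X]) (auto simp: \<eta>_def M_def \<nu>_def)
    have "(norm u)\<^sup>2 / \<eta> T \<le> D\<^sup>2 * (1 / \<eta> T)"
      using rad[OF \<open>u \<in> X\<close>] \<eta>_pos[of T] by (simp add: divide_right_mono power_mono)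
    also have "\<dots> = \<nu> + S" using \<open>D > 0\<close> by (simp add: inv S_def)
    finally have t1: "(norm u)\<^sup>2 / \<eta> T \<le> \<nu> + S" .
    have "(g T - M T) \<bullet> (x T - u) \<le> norm (g T - M T) * norm (x T - u)"
      by (rule norm_cauchy_schwarz)
    also have "\<dots> \<le> (2 * G) * D"
      using gM[of T] diam[of "x T" u] x[of T] \<open>T \<ge> 1\<close> \<open>u \<in> X\<close> G by (intro mult_mono) auto
    finally have t2: "(g T - M T) \<bullet> (x T - u) \<le> 2 * (D * G)" by (simp add: mult_ac)
    \<comment> \<open>Half of the quadratic term pays for Young's inequality; the other half is kept
      to absorb the movements that smoothness will produce.\<close>
    have "(x t - x (Suc t)) \<bullet> (g t - M t) - (\<Delta> t)\<^sup>2 / \<eta> t \<le> \<eta> t * a t / 2 - L / 2 * (\<Delta> t)\<^sup>2" for t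
    proof -
      define r where "r = norm (g t - M t)"
      have cs: "(x t - x (Suc t)) \<bullet> (g t - M t) \<le> \<Delta> t * r"
        unfolding \<Delta>_def r_def by (rule norm_cauchy_schwarz)
      have "0 \<le> (\<Delta> t - \<eta> t * r)\<^sup>2 / \<eta> t" using \<eta>_pos[of t] by simp
      also have "\<dots> = (\<Delta> t)\<^sup>2 / \<eta> t - 2 * (\<Delta> t * r) + \<eta> t * r\<^sup>2"
        using \<eta>_pos[of t] by (simp add: field_simps power2_eq_square)
      finally have young: "2 * (\<Delta> t * r) \<le> (\<Delta> t)\<^sup>2 / \<eta> t + \<eta> t * r\<^sup>2" by simp
      have "L * (\<Delta> t)\<^sup>2 \<le> 1 / \<eta> t * (\<Delta> t)\<^sup>2"
        using inv_ge by (intro mult_right_mono) auto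
      with cs young show ?thesis by (simp add: a_def r_def)
    qed
    then have "(\<Sum>t\<in>{1..<T}. (x t - x (Suc t)) \<bullet> (g t - M t) - (\<Delta> t)\<^sup>2 / \<eta> t)
        \<le> (\<Sum>t\<in>{1..<T}. \<eta> t * a t / 2 - L / 2 * (\<Delta> t)\<^sup>2)"
      by (intro sum_mono)
    also have "\<dots> = S / 2 - L / 2 * Q"
      by (simp add: S_def Q_def sum_subtractf sum_divide_distrib sum_distrib_left)
    finally have t3: "(\<Sum>t\<in>{1..<T}. (x t - x (Suc t)) \<bullet> (g t - M t) - (\<Delta> t)\<^sup>2 / \<eta> t)
        \<le> S / 2 - L / 2 * Q" .
    have "(\<Sum>t\<in>{1..<T}. a t) \<le> (\<Sum>t\<in>{1..T}. a t)"
      by (intro sum_mono2) (auto simp: a_def)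
    also have "\<dots> \<le> G\<^sup>2 + 6 * H + 3 * L\<^sup>2 * Q"
      using last_gradient_variation_le[OF lip, of T x g G] x g[of 1] \<open>T \<ge> 1\<close>
        zero_le_power2[of "norm (g T - m (x T))"]
      unfolding a_def M_def H_def Q_def \<Delta>_def by (smt (verit) atLeastAtMost_iff le_refl)
    finally have A: "(\<Sum>t\<in>{1..<T}. a t) \<le> G\<^sup>2 + 6 * H + 3 * L\<^sup>2 * Q" .
    have "S\<^sup>2 \<le> 6 * D\<^sup>2 * (\<Sum>t\<in>{1..<T}. a t)"
      unfolding S_def a_def \<eta>_def using \<open>D > 0\<close> \<nu> G L gM
      by (intro adaptive_step_sum_bound[where G = G]) (auto simp: \<nu>_def)
    also have "\<dots> \<le> 6 * D\<^sup>2 * (G\<^sup>2 + 6 * H + 3 * L\<^sup>2 * Q)"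
      using A by (intro mult_left_mono) auto
    also have "\<dots> = D\<^sup>2 * (6 * G\<^sup>2 + 36 * H + 18 * L\<^sup>2 * Q)"
      by (simp add: algebra_simps)
    \<comment> \<open>The coefficients 3, 6, 5 have squares at least 6, 36, 18, and the cross terms
      are nonnegative.\<close>
    also have "\<dots> \<le> D\<^sup>2 * (3 * G + 6 * sqrt H + 5 * L * sqrt Q)\<^sup>2"
    proof (intro mult_left_mono)
      have "(3 * G + 6 * sqrt H + 5 * L * sqrt Q)\<^sup>2 = 9 * G\<^sup>2 + 36 * (sqrt H)\<^sup>2 + 25 * L\<^sup>2 * (sqrt Q)\<^sup>2
          + 2 * (3 * G * (6 * sqrt H) + 3 * G * (5 * L * sqrt Q) + 6 * sqrt H * (5 * L * sqrt Q))"
        by (simp add: power2_sum power_mult_distrib algebra_simps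
            del: real_sqrt_pow2_iff real_sqrt_abs real_sqrt_pow2)
      moreover have "0 \<le> 3 * G * (6 * sqrt H) + 3 * G * (5 * L * sqrt Q) + 6 * sqrt H * (5 * L * sqrt Q)"
        using G H Q L by (intro add_nonneg_nonneg mult_nonneg_nonneg) auto
      moreover have "0 \<le> L\<^sup>2 * Q" "0 \<le> G\<^sup>2" using Q by auto
      ultimately show "6 * G\<^sup>2 + 36 * H + 18 * L\<^sup>2 * Q \<le> (3 * G + 6 * sqrt H + 5 * L * sqrt Q)\<^sup>2"
        using H Q by simp
    qed auto
    also have "\<dots> = (D * (3 * G + 6 * sqrt H + 5 * L * sqrt Q))\<^sup>2"
      by (simp add: power_mult_distrib)
    finally have "S \<le> D * (3 * G + 6 * sqrt H + 5 * L * sqrt Q)"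
      using \<open>D > 0\<close> G H L Q by (intro power2_le_imp_le[of S]) auto
    then have S: "S \<le> 3 * (D * G) + 6 * D * sqrt H + 5 * (L * (D * sqrt Q))"
      by (simp add: algebra_simps)
    \<comment> \<open>In total \<open>S\<close> occurs with factor 3/2, so
      \<open>15 / 2 * L * D * sqrt Q\<close> has to be absorbed by \<open>L / 2 * Q\<close>;
      completing the square costs \<open>225 / 8 * L * D\<^sup>2\<close>. Together with the
      \<open>L * D\<^sup>2\<close> in \<open>\<nu>\<close> this stays below 30, and 3/2 times 6 is
      the constant 9.\<close>
    have "0 \<le> (sqrt Q - 15 / 2 * D)\<^sup>2" by simp
    also have "\<dots> = (sqrt Q)\<^sup>2 - 15 * (D * sqrt Q) + 225 / 4 * D\<^sup>2"
      by (simp add: power2_eq_square algebra_simps)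
    finally have "L * (15 * (D * sqrt Q)) \<le> L * (Q + 225 / 4 * D\<^sup>2)"
      using L Q by (intro mult_left_mono) auto
    then have "15 * (L * (D * sqrt Q)) \<le> L * Q + 225 / 4 * (L * D\<^sup>2)"
      by (simp add: algebra_simps)
    moreover have "0 \<le> L * D\<^sup>2" "0 \<le> D * G" using L G \<open>D > 0\<close> by auto
    moreover have "\<nu> = L * D\<^sup>2 + D * G" by (rule \<nu>_def)
    ultimately show ?thesis using reg t1 t2 t3 S by linarith
  qed
  then show ?thesis unfolding H_def \<nu>_def .
qed

section \<open>Expectations under sampling without replacement\<close>

lemma expectation_pmf_mono:
  fixes F F' :: "'a \<Rightarrow> real"
  assumes "finite (set_pmf p)" "\<And>x. x \<in> set_pmf p \<Longrightarrow> F x \<le> F' x"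
  shows "measure_pmf.expectation p F \<le> measure_pmf.expectation p F'"
  using assms by (intro integral_mono_AE integrable_measure_pmf_finite) (auto intro: AE_pmfI)

lemma expectation_pmf_cong:
  fixes F F' :: "'a \<Rightarrow> real"
  assumes "\<And>x. x \<in> set_pmf p \<Longrightarrow> F x = F' x"
  shows "measure_pmf.expectation p F = measure_pmf.expectation p F'"
  using assms by (intro integral_cong_AE) (auto intro: AE_pmfI)

text \<open>Jensen's inequality for the square root, in the form that the variance of
  \<open>sqrt (F x)\<close> is nonnegative.\<close>

lemma expectation_sqrt_le:
  fixes F :: "'a \<Rightarrow> real"
  assumes fin: "finite (set_pmf p)" and nonneg: "\<And>x. F x \<ge> 0"
  shows "measure_pmf.expectation p (\<lambda>x. sqrt (F x)) \<le> sqrt (measure_pmf.expectation p F)"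
proof -
  have "(measure_pmf.expectation p (\<lambda>x. sqrt (F x)))\<^sup>2
      \<le> measure_pmf.expectation p (\<lambda>x. (sqrt (F x))\<^sup>2)"
    using measure_pmf.variance_eq[OF integrable_measure_pmf_finite[OF fin]
        integrable_measure_pmf_finite[OF fin], of "\<lambda>x. sqrt (F x)"]
      measure_pmf.variance_positive[of p "\<lambda>x. sqrt (F x)"]
    by linarith
  then show ?thesis using nonneg by (intro real_le_rsqrt) simp
qed

lemma set_draw_without_replacement:
  assumes "n \<le> T" "\<xi> \<in> set_pmf (draw_without_replacement T n)"
  shows "length \<xi> = n" "distinct \<xi>" "set \<xi> \<subseteq> {1..T}"
proof -
  have "length \<xi> = n \<and> distinct \<xi> \<and> set \<xi> \<subseteq> {1..T}" using assms
  proof (induction n arbitrary: \<xi>)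
    case (Suc n)
    then obtain \<zeta> k where \<zeta>: "\<zeta> \<in> set_pmf (draw_without_replacement T n)" "\<xi> = \<zeta> @ [k]"
      and k: "k \<in> set_pmf (pmf_of_set ({1..T} - set \<zeta>))" by auto
    have IH: "length \<zeta> = n" "distinct \<zeta>" "set \<zeta> \<subseteq> {1..T}" using Suc \<zeta> by auto
    then have "card ({1..T} - set \<zeta>) = T - n"
      by (simp add: card_Diff_subset distinct_card)
    \<comment> \<open>\<open>pmf_of_set\<close> has its intended meaning only on nonempty finite
      sets; this is where \<open>n \<le> T\<close> enters.\<close>
    then have "{1..T} - set \<zeta> \<noteq> {}" using Suc.prems by (metis card.empty diff_is_0_eq not_less_eq_eq)
    then have "k \<in> {1..T} - set \<zeta>" using k by simp
    then show ?case using IH \<zeta> by auto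
  qed auto
  then show "length \<xi> = n" "distinct \<xi>" "set \<xi> \<subseteq> {1..T}" by auto
qed

lemma card_unused:
  assumes "n \<le> T" "\<xi> \<in> set_pmf (draw_without_replacement T n)"
  shows "card ({1..T} - set \<xi>) = T - n"
  using set_draw_without_replacement[OF assms] by (simp add: card_Diff_subset distinct_card)

lemma finite_set_draw_without_replacement:
  assumes "n \<le> T"
  shows "finite (set_pmf (draw_without_replacement T n))"
  by (rule finite_subset[OF _ finite_lists_length_eq[of "{1..T}" n]])
     (use set_draw_without_replacement[OF assms] in auto)

text \<open>The learner is specified along complete orders only. Realising each reachable history as
  a prefix of a complete order transfers those properties to its decision after that
  history.\<close>

lemma draw_without_replacement_extend:
  assumes "n \<le> m" "m \<le> T" "\<xi> \<in> set_pmf (draw_without_replacement T n)"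
  shows "\<exists>\<zeta>\<in>set_pmf (draw_without_replacement T m). take n \<zeta> = \<xi>"
  using assms(1,2)
proof (induction m rule: dec_induct)
  case base
  show ?case using assms set_draw_without_replacement(1)[of n T \<xi>] by (intro bexI[of _ \<xi>]) auto
next
  case (step m)
  then obtain \<zeta> where \<zeta>: "\<zeta> \<in> set_pmf (draw_without_replacement T m)" "take n \<zeta> = \<xi>" by auto
  have len: "length \<zeta> = m" using \<zeta> step.prems by (intro set_draw_without_replacement(1)) auto
  have "card ({1..T} - set \<zeta>) \<noteq> 0" using card_unused[OF _ \<zeta>(1)] step.prems by simp
  then have ne: "{1..T} - set \<zeta> \<noteq> {}" by (metis card.empty)
  then obtain k where "k \<in> {1..T} - set \<zeta>" by blast
  with \<zeta> ne have "\<zeta> @ [k] \<in> set_pmf (draw_without_replacement T (Suc m))"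
    by (auto intro!: bexI[of _ \<zeta>] simp: set_pmf_of_set[OF ne] simp del: One_nat_def)
  moreover have "take n (\<zeta> @ [k]) = \<xi>" using \<zeta> len step.hyps by simp
  ultimately show ?case by blast
qed

lemma expectation_draw_Suc:
  fixes F :: "nat list \<Rightarrow> real"
  assumes "n < T"
  shows "measure_pmf.expectation (draw_without_replacement T (Suc n)) F
    = measure_pmf.expectation (draw_without_replacement T n)
        (\<lambda>\<xi>. (\<Sum>k\<in>{1..T} - set \<xi>. F (\<xi> @ [k])) / real (T - n))"
proof -
  let ?p = "draw_without_replacement T n"
  let ?q = "\<lambda>\<xi>. map_pmf (\<lambda>k. \<xi> @ [k]) (pmf_of_set ({1..T} - set \<xi>))"
  have fin: "finite (set_pmf ?p)" using assms by (intro finite_set_draw_without_replacement) simp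
  have ne: "{1..T} - set \<xi> \<noteq> {}" if "\<xi> \<in> set_pmf ?p" for \<xi>
    using card_unused[OF _ that] assms by (metis card.empty less_imp_le zero_less_diff less_irrefl)
  have q: "measure_pmf.expectation (?q \<xi>) F = (\<Sum>k\<in>{1..T} - set \<xi>. F (\<xi> @ [k])) / real (T - n)"
    if "\<xi> \<in> set_pmf ?p" for \<xi>
    using ne[OF that] card_unused[OF less_imp_le[OF assms] that]
    by (simp add: integral_pmf_of_set del: One_nat_def of_nat_diff)
  have "measure_pmf.expectation (draw_without_replacement T (Suc n)) F
      = (\<Sum>\<xi>\<in>set_pmf ?p. pmf ?p \<xi> *\<^sub>R measure_pmf.expectation (?q \<xi>) F)"
    using fin ne by (simp add: pmf_expectation_bind[OF fin])
  also have "\<dots> = (\<Sum>\<xi>\<in>set_pmf ?p. pmf ?p \<xi> *\<^sub>R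
      ((\<Sum>k\<in>{1..T} - set \<xi>. F (\<xi> @ [k])) / real (T - n)))"
    using q by (intro sum.cong) auto
  also have "\<dots> = measure_pmf.expectation ?p
      (\<lambda>\<xi>. (\<Sum>k\<in>{1..T} - set \<xi>. F (\<xi> @ [k])) / real (T - n))"
    by (rule integral_measure_pmf[symmetric]) (use fin in auto)
  finally show ?thesis .
qed

lemma expectation_sum_drawn:
  fixes \<phi> :: "nat \<Rightarrow> real"
  assumes "n \<le> T"
  shows "measure_pmf.expectation (draw_without_replacement T n) (\<lambda>\<xi>. \<Sum>k\<in>set \<xi>. \<phi> k)
    = real n / real T * (\<Sum>k\<in>{1..T}. \<phi> k)"
  using assms
proof (induction n)
  case (Suc n)
  let ?p = "draw_without_replacement T n" and ?\<Phi> = "\<Sum>k\<in>{1..T}. \<phi> k"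
  have int: "integrable (measure_pmf ?p) F" for F :: "nat list \<Rightarrow> real"
    using Suc by (intro integrable_measure_pmf_finite finite_set_draw_without_replacement) auto
  have Tn: "real (T - n) > 0" using Suc by simp
  have "measure_pmf.expectation (draw_without_replacement T (Suc n)) (\<lambda>\<xi>. \<Sum>k\<in>set \<xi>. \<phi> k)
      = measure_pmf.expectation ?p
          (\<lambda>\<xi>. (\<Sum>k\<in>{1..T} - set \<xi>. \<Sum>j\<in>set (\<xi> @ [k]). \<phi> j) / real (T - n))"
    using Suc by (intro expectation_draw_Suc) auto
  also have "\<dots> = measure_pmf.expectation ?p
      (\<lambda>\<xi>. (1 - 1 / real (T - n)) * (\<Sum>k\<in>set \<xi>. \<phi> k) + ?\<Phi> / real (T - n))"
  proof (rule expectation_pmf_cong)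
    fix \<xi> assume \<xi>: "\<xi> \<in> set_pmf ?p"
    have "(\<Sum>k\<in>{1..T} - set \<xi>. \<Sum>j\<in>set (\<xi> @ [k]). \<phi> j)
        = (\<Sum>k\<in>{1..T} - set \<xi>. \<phi> k + (\<Sum>j\<in>set \<xi>. \<phi> j))"
      by (intro sum.cong) auto
    also have "\<dots> = ?\<Phi> - (\<Sum>j\<in>set \<xi>. \<phi> j) + real (T - n) * (\<Sum>j\<in>set \<xi>. \<phi> j)"
      using card_unused[OF _ \<xi>] set_draw_without_replacement(3)[OF _ \<xi>] Suc.prems
      by (simp add: sum.distrib sum_diff)
    finally show "(\<Sum>k\<in>{1..T} - set \<xi>. \<Sum>j\<in>set (\<xi> @ [k]). \<phi> j) / real (T - n)
        = (1 - 1 / real (T - n)) * (\<Sum>k\<in>set \<xi>. \<phi> k) + ?\<Phi> / real (T - n)"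
      using Tn by (simp add: add_divide_distrib diff_divide_distrib left_diff_distrib del: of_nat_diff)
  qed
  also have "\<dots> = (1 - 1 / real (T - n)) * (real n / real T * ?\<Phi>) + ?\<Phi> / real (T - n)"
    using Suc by (subst Bochner_Integration.integral_add) (auto intro: int)
  also have "\<dots> = real (Suc n) / real T * ?\<Phi>"
  proof -
    define d where "d = real (T - n)"
    have d: "d > 0" "real T = real n + d" using Suc.prems by (auto simp: d_def)
    then have "(1 - 1 / d) * (real n / real T) + 1 / d = real (Suc n) / real T"
      unfolding d(2) by (simp add: divide_simps add_pos_nonneg) (simp add: algebra_simps)
    then have "(1 - 1 / real (T - n)) * (real n / real T) + 1 / real (T - n) = real (Suc n) / real T"
      unfolding d_def .
    then have "((1 - 1 / real (T - n)) * (real n / real T) + 1 / real (T - n)) * ?\<Phi>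
        = real (Suc n) / real T * ?\<Phi>" by simp
    then show ?thesis by (simp only: distrib_right mult.assoc times_divide_eq_left mult_1_left)
  qed
  finally show ?case .
qed simp

text \<open>
  Given the past, the next index is uniform on the \<open>T - n\<close> unused ones, which yields \<open>B / (T - n)\<close>;
  without conditioning it is uniform on all of them, which yields the mean of \<open>\<phi>\<close>.
\<close>

lemma expectation_sum_adaptive_le:
  fixes h :: "nat \<Rightarrow> 'a \<Rightarrow> real"
  assumes nonneg: "\<And>k y. h k y \<ge> 0"
    and B: "\<And>n \<xi>. n < T \<Longrightarrow> \<xi> \<in> set_pmf (draw_without_replacement T n)
      \<Longrightarrow> (\<Sum>k\<in>{1..T}. h k (A \<xi>)) \<le> B"
    and \<phi>: "\<And>n \<xi> k. n < T \<Longrightarrow> \<xi> \<in> set_pmf (draw_without_replacement T n)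
      \<Longrightarrow> k \<in> {1..T} \<Longrightarrow> h k (A \<xi>) \<le> \<phi> k"
    and "n \<le> T"
  shows "measure_pmf.expectation (draw_without_replacement T n) (\<lambda>\<xi>. \<Sum>i<n. h (\<xi> ! i) (A (take i \<xi>)))
    \<le> (\<Sum>i<n. min (B / real (T - i)) ((\<Sum>k\<in>{1..T}. \<phi> k) / real T))"
  using \<open>n \<le> T\<close>
proof (induction n)
  case (Suc n)
  let ?p = "draw_without_replacement T n" and ?\<Phi> = "\<Sum>k\<in>{1..T}. \<phi> k"
  let ?V = "\<lambda>\<xi>. \<Sum>i<n. h (\<xi> ! i) (A (take i \<xi>))"
  let ?W = "\<lambda>\<xi>. (\<Sum>k\<in>{1..T} - set \<xi>. h k (A \<xi>)) / real (T - n)"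
  have fin: "finite (set_pmf ?p)" using Suc by (intro finite_set_draw_without_replacement) auto
  have int: "integrable (measure_pmf ?p) F" for F :: "nat list \<Rightarrow> real"
    by (intro integrable_measure_pmf_finite fin)
  have Tn: "real (T - n) > 0" using Suc by simp
  have "measure_pmf.expectation (draw_without_replacement T (Suc n))
        (\<lambda>\<xi>. \<Sum>i<Suc n. h (\<xi> ! i) (A (take i \<xi>)))
      = measure_pmf.expectation ?p (\<lambda>\<xi>. (\<Sum>k\<in>{1..T} - set \<xi>.
          \<Sum>i<Suc n. h ((\<xi> @ [k]) ! i) (A (take i (\<xi> @ [k])))) / real (T - n))"
    using Suc by (intro expectation_draw_Suc) auto
  also have "\<dots> = measure_pmf.expectation ?p (\<lambda>\<xi>. ?V \<xi> + ?W \<xi>)"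
  proof (rule expectation_pmf_cong)
    fix \<xi> assume \<xi>: "\<xi> \<in> set_pmf ?p"
    have len: "length \<xi> = n" using \<xi> Suc by (intro set_draw_without_replacement(1)) auto
    have "(\<Sum>i<Suc n. h ((\<xi> @ [k]) ! i) (A (take i (\<xi> @ [k])))) = ?V \<xi> + h k (A \<xi>)" for k
      using len by (simp add: nth_append)
    then show "(\<Sum>k\<in>{1..T} - set \<xi>. \<Sum>i<Suc n. h ((\<xi> @ [k]) ! i) (A (take i (\<xi> @ [k])))) / real (T - n)
        = ?V \<xi> + ?W \<xi>"
      using card_unused[OF _ \<xi>] Suc.prems Tn by (simp add: sum.distrib field_simps)
  qed
  also have "\<dots> = measure_pmf.expectation ?p ?V + measure_pmf.expectation ?p ?W"
    by (intro Bochner_Integration.integral_add int)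
  also have "\<dots> \<le> (\<Sum>i<n. min (B / real (T - i)) (?\<Phi> / real T)) + min (B / real (T - n)) (?\<Phi> / real T)"
  proof (intro add_mono min.boundedI)
    show "measure_pmf.expectation ?p ?V \<le> (\<Sum>i<n. min (B / real (T - i)) (?\<Phi> / real T))"
      using Suc by simp
    have "?W \<xi> \<le> B / real (T - n)" if \<xi>: "\<xi> \<in> set_pmf ?p" for \<xi>
    proof -
      have "(\<Sum>k\<in>{1..T} - set \<xi>. h k (A \<xi>)) \<le> (\<Sum>k\<in>{1..T}. h k (A \<xi>))"
        using nonneg by (intro sum_mono2) auto
      also have "\<dots> \<le> B" using \<xi> Suc.prems by (intro B) auto
      finally show ?thesis by (intro divide_right_mono) auto
    qed
    then have "measure_pmf.expectation ?p ?W \<le> measure_pmf.expectation ?p (\<lambda>_. B / real (T - n))"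
      by (intro expectation_pmf_mono fin)
    then show "measure_pmf.expectation ?p ?W \<le> B / real (T - n)" by simp
    \<comment> \<open>The decision depends on the history, so it is first removed by the envelope
      \<open>\<phi>\<close>; what remains depends only on the set of drawn indices and has a known
      expectation.\<close>
    have "?W \<xi> \<le> (?\<Phi> - (\<Sum>k\<in>set \<xi>. \<phi> k)) / real (T - n)" if \<xi>: "\<xi> \<in> set_pmf ?p" for \<xi>
    proof -
      have "(\<Sum>k\<in>{1..T} - set \<xi>. h k (A \<xi>)) \<le> (\<Sum>k\<in>{1..T} - set \<xi>. \<phi> k)"
        using \<xi> Suc.prems by (intro sum_mono \<phi>) auto
      also have "\<dots> = ?\<Phi> - (\<Sum>k\<in>set \<xi>. \<phi> k)"
        using set_draw_without_replacement(3)[OF _ \<xi>] Suc.prems by (intro sum_diff) auto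
      finally show ?thesis by (intro divide_right_mono) auto
    qed
    then have "measure_pmf.expectation ?p ?W
        \<le> measure_pmf.expectation ?p (\<lambda>\<xi>. (?\<Phi> - (\<Sum>k\<in>set \<xi>. \<phi> k)) / real (T - n))"
      by (intro expectation_pmf_mono fin)
    also have "\<dots> = (?\<Phi> - real n / real T * ?\<Phi>) / real (T - n)"
      using expectation_sum_drawn[of n T \<phi>] Suc.prems
      by (simp add: Bochner_Integration.integral_diff[OF int int])
    also have "\<dots> = ?\<Phi> / real T"
      using Suc.prems by (simp add: of_nat_diff field_simps)
    finally show "measure_pmf.expectation ?p ?W \<le> ?\<Phi> / real T" .
  qed
  finally show ?case by simp
qed simp

section \<open>The logarithmic sum\<close>

text \<open>The logarithm telescopes because \<open>b / (1 + b * m) \<ge> min (1 / m) b / 2\<close>.\<close>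

lemma sum_min_inverse_le:
  fixes b :: real
  assumes "b \<ge> 0"
  shows "(\<Sum>m\<in>{1..n}. min (1 / real m) b) \<le> 2 * ln (1 + b * real n)"
proof (induction n)
  case (Suc n)
  let ?m = "real (Suc n)"
  have p: "1 + b * real n > 0" "1 + b * ?m > 0" using assms by (auto intro: add_pos_nonneg)
  have "min (1 / ?m) b * (1 + b * ?m) \<le> 2 * b"
  proof (cases "b * ?m \<le> 1")
    case True
    have "min (1 / ?m) b * (1 + b * ?m) \<le> b * 2" using True assms by (intro mult_mono) auto
    then show ?thesis by simp
  next
    case False
    have "min (1 / ?m) b * (1 + b * ?m) \<le> (1 / ?m) * (2 * (b * ?m))"
      using False assms by (intro mult_mono) auto
    then show ?thesis by simp
  qed
  then have 1: "min (1 / ?m) b \<le> 2 * (b / (1 + b * ?m))" using p by (simp add: field_simps)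
  have "ln ((1 + b * real n) / (1 + b * ?m)) \<le> (1 + b * real n) / (1 + b * ?m) - 1"
    using p by (intro ln_le_minus_one divide_pos_pos)
  also have "\<dots> = - (b / (1 + b * ?m))" using p by (simp add: field_simps)
  finally have "b / (1 + b * ?m) \<le> ln (1 + b * ?m) - ln (1 + b * real n)"
    using p by (simp add: ln_div)
  then show ?case using Suc 1 by (simp del: of_nat_Suc)
qed simp

lemma sum_min_variance_le:
  fixes \<sigma> \<tau> :: real
  assumes "0 \<le> \<sigma>" "\<sigma> \<le> \<tau>" "T \<ge> 1"
  shows "(\<Sum>i<T. min (real T * \<sigma>\<^sup>2 / real (T - i)) (\<tau>\<^sup>2))
    \<le> 4 * \<sigma>\<^sup>2 * ln (exp 1 * (\<tau> / \<sigma>)) * real T"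
proof (cases "\<sigma> = 0")
  \<comment> \<open>Every minimum is at most 0, and the factor \<open>\<sigma>\<^sup>2\<close> makes
    the bound 0 whatever value the logarithm takes at a quotient by 0.\<close>
  case True
  then show ?thesis by (auto intro!: sum_nonpos)
next
  case False
  define r where "r = \<tau> / \<sigma>"
  have \<sigma>: "\<sigma> > 0" and r: "r \<ge> 1" using assms False by (auto simp: r_def)
  have \<tau>: "\<tau>\<^sup>2 = real T * \<sigma>\<^sup>2 * (r\<^sup>2 / real T)"
    using \<sigma> assms by (simp add: r_def power_divide)
  have "(\<Sum>i<T. min (real T * \<sigma>\<^sup>2 / real (T - i)) (\<tau>\<^sup>2))
      = (\<Sum>m\<in>{1..T}. min (real T * \<sigma>\<^sup>2 / real m) (\<tau>\<^sup>2))"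
    by (rule sum.reindex_bij_witness[of _ "\<lambda>m. T - m" "\<lambda>i. T - i"]) auto
  also have "\<dots> = real T * \<sigma>\<^sup>2 * (\<Sum>m\<in>{1..T}. min (1 / real m) (r\<^sup>2 / real T))"
    unfolding \<tau> sum_distrib_left by (intro sum.cong refl) (simp add: min_mult_distrib_left)
  also have "\<dots> \<le> real T * \<sigma>\<^sup>2 * (2 * ln (1 + r\<^sup>2 / real T * real T))"
    by (intro mult_left_mono sum_min_inverse_le) auto
  also have "\<dots> = real T * \<sigma>\<^sup>2 * (2 * ln (1 + r\<^sup>2))" using assms by simp
  also have "\<dots> \<le> real T * \<sigma>\<^sup>2 * (2 * ln ((exp 1 * r)\<^sup>2))"
  proof -
    \<comment> \<open>Since \<open>e \<ge> 2\<close> and \<open>r \<ge> 1\<close>,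
      \<open>1 + r^2 \<le> 4 r^2 \<le> (e r)^2\<close>; the square then leaves the logarithm as a
      second factor 2.\<close>
    have "(2::real)\<^sup>2 \<le> (exp 1)\<^sup>2" using exp_ge_add_one_self[of 1] by (intro power_mono) auto
    then have "4 * r\<^sup>2 \<le> (exp 1)\<^sup>2 * r\<^sup>2" by (intro mult_right_mono) auto
    moreover have "1 \<le> r\<^sup>2" using r by simp
    ultimately have "1 + r\<^sup>2 \<le> (exp 1 * r)\<^sup>2" by (simp add: power_mult_distrib)
    then have "ln (1 + r\<^sup>2) \<le> ln ((exp 1 * r)\<^sup>2)"
      using \<open>1 \<le> r\<^sup>2\<close> by (intro ln_mono) auto
    then show ?thesis by (intro mult_left_mono) auto
  qed
  also have "ln ((exp 1 * r)\<^sup>2) = 2 * ln (exp 1 * r)" using r by (simp add: ln_realpow)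
  finally show ?thesis unfolding r_def by (simp add: mult_ac)
qed

section \<open>The two variances\<close>

abbreviation squared_deviation :: "nat \<Rightarrow> (nat \<Rightarrow> 'a::real_inner \<Rightarrow> 'a) \<Rightarrow> nat \<Rightarrow> 'a \<Rightarrow> real" where
  "squared_deviation T grad k y \<equiv> (norm (grad k y - mean_gradient T grad y))\<^sup>2"

text \<open>A real supremum is meaningful only over a nonempty set that is bounded above; these
  assumptions guarantee this for the suprema in \<open>sigma1\<close> and
  \<open>sigma1_tilde\<close>.\<close>

locale bounded_gradients =
  fixes X :: "'a::real_inner set" and T :: nat and grad :: "nat \<Rightarrow> 'a \<Rightarrow> 'a" and G :: real
  assumes T: "T \<ge> 1" and ne: "X \<noteq> {}"
    and grad: "\<And>k y. k \<in> {1..T} \<Longrightarrow> y \<in> X \<Longrightarrow> norm (grad k y) \<le> G"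
begin

lemma deviation_bdd:
  assumes "k \<in> {1..T}" "y \<in> X"
  shows "squared_deviation T grad k y \<le> (2 * G)\<^sup>2"
proof -
  have "norm (mean_gradient T grad y) = (1 / real T) * norm (\<Sum>s\<in>{1..T}. grad s y)"
    by (simp add: mean_gradient_def)
  also have "\<dots> \<le> (1 / real T) * (\<Sum>s\<in>{1..T}. G)"
    using grad assms by (intro mult_left_mono sum_norm_le) auto
  also have "\<dots> = G" using T by simp
  finally have "norm (grad k y - mean_gradient T grad y) \<le> 2 * G"
    using grad[OF assms] norm_triangle_ineq4[of "grad k y" "mean_gradient T grad y"] by simp
  then show ?thesis by (intro power_mono) auto
qed

lemma deviation_le_SUP:
  assumes "k \<in> {1..T}" "y \<in> X"
  shows "squared_deviation T grad k y \<le> (SUP x\<in>X. squared_deviation T grad k x)"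
  using deviation_bdd assms by (intro cSUP_upper bdd_aboveI2[where M = "(2 * G)\<^sup>2"]) auto

lemma SUP_deviation_nonneg: "k \<in> {1..T} \<Longrightarrow> 0 \<le> (SUP x\<in>X. squared_deviation T grad k x)"
  using deviation_le_SUP ne by (meson ex_in_conv order_trans zero_le_power2)

lemma sigma1_tilde_squared: "(sigma1_tilde X T grad)\<^sup>2
    = (\<Sum>k\<in>{1..T}. SUP x\<in>X. squared_deviation T grad k x) / real T"
  unfolding sigma1_tilde_def
  by (subst real_sqrt_pow2) (auto intro!: divide_nonneg_nonneg sum_nonneg SUP_deviation_nonneg)

text \<open>This serves twice: it bounds the supremum in \<open>sigma1\<close> from above, and it
  yields \<open>sigma1 \<le> sigma1_tilde\<close>.\<close>

lemma mean_deviation_le: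
  assumes "y \<in> X"
  shows "(1 / real T) * (\<Sum>t\<in>{1..T}. squared_deviation T grad t y) \<le> (sigma1_tilde X T grad)\<^sup>2"
proof -
  have "(\<Sum>t\<in>{1..T}. squared_deviation T grad t y) / real T
      \<le> (\<Sum>t\<in>{1..T}. SUP x\<in>X. squared_deviation T grad t x) / real T"
    using assms by (intro divide_right_mono sum_mono deviation_le_SUP) auto
  then show ?thesis unfolding sigma1_tilde_squared by simp
qed

lemma mean_deviation_le_sigma1:
  assumes "y \<in> X"
  shows "(1 / real T) * (\<Sum>t\<in>{1..T}. squared_deviation T grad t y)
    \<le> (SUP x\<in>X. (1 / real T) * (\<Sum>t\<in>{1..T}. squared_deviation T grad t x))"
  using mean_deviation_le assms
  by (intro cSUP_upper bdd_aboveI2[where M = "(sigma1_tilde X T grad)\<^sup>2"]) auto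

lemma sigma1_nonneg: "0 \<le> sigma1 X T grad"
  and sum_deviation_le_sigma1: "y \<in> X
    \<Longrightarrow> (\<Sum>t\<in>{1..T}. squared_deviation T grad t y) \<le> real T * (sigma1 X T grad)\<^sup>2"
  and sigma1_le_sigma1_tilde: "sigma1 X T grad \<le> sigma1_tilde X T grad"
proof -
  let ?s = "SUP x\<in>X. (1 / real T) * (\<Sum>t\<in>{1..T}. squared_deviation T grad t x)"
  obtain z where "z \<in> X" using ne by auto
  have "0 \<le> (1 / real T) * (\<Sum>t\<in>{1..T}. squared_deviation T grad t z)"
    by (auto intro!: divide_nonneg_nonneg sum_nonneg)
  also have "\<dots> \<le> ?s" using \<open>z \<in> X\<close> by (rule mean_deviation_le_sigma1)
  finally have s: "0 \<le> ?s" .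
  then show "0 \<le> sigma1 X T grad" by (simp add: sigma1_def)
  have sq: "(sigma1 X T grad)\<^sup>2 = ?s" using s by (simp add: sigma1_def)
  show "(\<Sum>t\<in>{1..T}. squared_deviation T grad t y) \<le> real T * (sigma1 X T grad)\<^sup>2" if "y \<in> X"
    using mean_deviation_le_sigma1[OF that] T unfolding sq by (simp add: field_simps)
  have "(sigma1 X T grad)\<^sup>2 \<le> (sigma1_tilde X T grad)\<^sup>2"
    unfolding sq using ne by (intro cSUP_least mean_deviation_le)
  moreover have "0 \<le> sigma1_tilde X T grad"
    unfolding sigma1_tilde_def
    by (auto intro!: divide_nonneg_nonneg sum_nonneg SUP_deviation_nonneg)
  ultimately show "sigma1 X T grad \<le> sigma1_tilde X T grad" by (rule power2_le_imp_le)
qed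

end

section \<open>Expected regret\<close>

lemma lipschitz_on_mean_gradient:
  assumes "T \<ge> 1" "\<And>k. k \<in> {1..T} \<Longrightarrow> L-lipschitz_on X (grad k)"
  shows "L-lipschitz_on X (mean_gradient T grad)"
proof (rule lipschitz_onI)
  show "0 \<le> L" using assms(2)[of 1] assms(1) by (simp add: lipschitz_on_def)
  fix x y assume "x \<in> X" "y \<in> X"
  have "dist (mean_gradient T grad x) (mean_gradient T grad y)
      = (1 / real T) * norm (\<Sum>s\<in>{1..T}. grad s x - grad s y)"
    by (simp add: mean_gradient_def dist_norm sum_subtractf flip: scaleR_diff_right)
  also have "\<dots> \<le> (1 / real T) * (\<Sum>s\<in>{1..T}. L * dist x y)"
    using assms(2) \<open>x \<in> X\<close> \<open>y \<in> X\<close>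
    by (intro mult_left_mono sum_norm_le) (auto simp: lipschitz_on_def dist_norm)
  also have "\<dots> = L * dist x y" using assms(1) by simp
  finally show "dist (mean_gradient T grad x) (mean_gradient T grad y) \<le> L * dist x y" .
qed

text \<open>The bound for a fixed order is averaged with \<open>m\<close> the mean gradient. The
  constant 18 is the 9 from that bound times the square root of the 4 in
  \<open>sum_min_variance_le\<close>.\<close>

lemma oftrl_expected_regret:
  fixes X :: "'a::real_inner set"
  assumes "convex X" "u \<in> X" and T: "T \<ge> 1" and "D > 0"
    and diam: "\<And>y z. y \<in> X \<Longrightarrow> z \<in> X \<Longrightarrow> norm (y - z) \<le> D"
    and rad: "\<And>y. y \<in> X \<Longrightarrow> norm y \<le> D"
    and lip: "\<And>k. k \<in> {1..T} \<Longrightarrow> L-lipschitz_on X (grad k)"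
    and grad: "\<And>k y. k \<in> {1..T} \<Longrightarrow> y \<in> X \<Longrightarrow> norm (grad k y) \<le> G"
    and learner: "oftrl_learner X T D (L * D\<^sup>2 + D * G) grad A"
  shows "measure_pmf.expectation (random_order T)
         (\<lambda>\<xi>. regret T (observed_gradient grad A \<xi>) (decision A \<xi>) u)
       \<le> 18 * (D * sigma1 X T grad
                * sqrt (ln (exp 1 * (sigma1_tilde X T grad / sigma1 X T grad)) * real T))
         + 30 * (L * D\<^sup>2 + D * G)"
proof -
  let ?\<sigma> = "sigma1 X T grad" and ?\<tau> = "sigma1_tilde X T grad" and ?p = "random_order T"
  let ?h = "squared_deviation T grad"
  define H where "H \<xi> = (\<Sum>i<T. ?h (\<xi> ! i) (A (take i \<xi>)))" for \<xi>
  define E where "E = measure_pmf.expectation ?p H"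
  interpret bounded_gradients X T grad G
    using T grad \<open>u \<in> X\<close> by unfold_locales auto
  note \<sigma> = sigma1_nonneg sigma1_le_sigma1_tilde
  have fin: "finite (set_pmf ?p)"
    unfolding random_order_def by (rule finite_set_draw_without_replacement) simp
  have dec: "decision A \<xi> t \<in> X" if "\<xi> \<in> set_pmf ?p" "t \<in> {1..T}" for \<xi> t
    using learner that by (auto simp: oftrl_learner_def oftrl_run_def Let_def is_arg_min_def)
  have A: "A \<xi> \<in> X" if n: "n < T" and \<xi>: "\<xi> \<in> set_pmf (draw_without_replacement T n)" for n \<xi>
  proof -
    obtain \<zeta> where "\<zeta> \<in> set_pmf ?p" "take n \<zeta> = \<xi>"
      using draw_without_replacement_extend[OF _ _ \<xi>, of T] n by (auto simp: random_order_def)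
    then show ?thesis using dec[of \<zeta> "Suc n"] n by (simp add: decision_def)
  qed
  \<comment> \<open>Here \<open>B\<close> is \<open>T\<close> times the square of
    \<open>sigma1\<close>, and \<open>\<phi> k\<close> is the supremum over \<open>X\<close> of the
    deviation of index \<open>k\<close>.\<close>
  have "E \<le> (\<Sum>i<T. min (real T * ?\<sigma>\<^sup>2 / real (T - i)) ((\<Sum>k\<in>{1..T}. SUP x\<in>X. ?h k x) / real T))"
    unfolding E_def H_def random_order_def
    using sum_deviation_le_sigma1 deviation_le_SUP
    by (intro expectation_sum_adaptive_le) (auto intro: A)
  also have "\<dots> = (\<Sum>i<T. min (real T * ?\<sigma>\<^sup>2 / real (T - i)) (?\<tau>\<^sup>2))"
    by (simp only: sigma1_tilde_squared)
  also have "\<dots> \<le> 4 * ?\<sigma>\<^sup>2 * ln (exp 1 * (?\<tau> / ?\<sigma>)) * real T"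
    using \<sigma> T by (intro sum_min_variance_le) auto
  finally have "sqrt E \<le> sqrt (4 * ?\<sigma>\<^sup>2 * (ln (exp 1 * (?\<tau> / ?\<sigma>)) * real T))"
    by (simp add: mult.assoc)
  also have "\<dots> = 2 * ?\<sigma> * sqrt (ln (exp 1 * (?\<tau> / ?\<sigma>)) * real T)"
    using \<sigma> by (simp add: real_sqrt_mult)
  finally have E: "sqrt E \<le> 2 * ?\<sigma> * sqrt (ln (exp 1 * (?\<tau> / ?\<sigma>)) * real T)" .
  have "regret T (observed_gradient grad A \<xi>) (decision A \<xi>) u
      \<le> 9 * D * sqrt (H \<xi>) + 30 * (L * D\<^sup>2 + D * G)" if \<xi>: "\<xi> \<in> set_pmf ?p" for \<xi>
  proof -
    have idx: "\<xi> ! (t - 1) \<in> {1..T}" if "t \<in> {1..T}" for t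
    proof -
      have "length \<xi> = T" "set \<xi> \<subseteq> {1..T}"
        using set_draw_without_replacement[of T T \<xi>] \<xi> unfolding random_order_def by blast+
      moreover have "t - 1 < T" using that by auto
      ultimately show ?thesis using nth_mem[of "t - 1" \<xi>] by blast
    qed
    \<comment> \<open>List positions start at 0 and rounds at 1.\<close>
    have "H \<xi> = (\<Sum>t\<in>{1..T}. ?h (\<xi> ! (t - 1)) (decision A \<xi> t))"
      unfolding H_def decision_def
      by (rule sum.reindex_bij_witness[of _ "\<lambda>t. t - 1" Suc]) auto
    moreover have "regret T (observed_gradient grad A \<xi>) (decision A \<xi>) u
        \<le> 9 * D * sqrt (\<Sum>t\<in>{1..T}. (norm (observed_gradient grad A \<xi> t
            - mean_gradient T grad (decision A \<xi> t)))\<^sup>2) + 30 * (L * D\<^sup>2 + D * G)"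
    proof (rule oftrl_pathwise_regret[OF _ assms(1-4) diam rad])
      show "oftrl_run X T (last_gradient (observed_gradient grad A \<xi>))
          (adaptive_step D (L * D\<^sup>2 + D * G) (last_gradient (observed_gradient grad A \<xi>))
            (observed_gradient grad A \<xi>)) (observed_gradient grad A \<xi>) (decision A \<xi>)"
        using learner \<xi> by (simp add: oftrl_learner_def Let_def)
      show "norm (observed_gradient grad A \<xi> t) \<le> G" if "t \<in> {1..T}" for t
        unfolding observed_gradient_def using that by (intro grad idx dec[OF \<xi>])
      show "L-lipschitz_on X (mean_gradient T grad)"
        using T lip by (rule lipschitz_on_mean_gradient)
    qed
    ultimately show ?thesis by (simp add: observed_gradient_def)
  qed
  then have "measure_pmf.expectation ?p
         (\<lambda>\<xi>. regret T (observed_gradient grad A \<xi>) (decision A \<xi>) u)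
      \<le> measure_pmf.expectation ?p (\<lambda>\<xi>. 9 * D * sqrt (H \<xi>) + 30 * (L * D\<^sup>2 + D * G))"
    by (intro expectation_pmf_mono fin)
  also have "\<dots> = 9 * D * measure_pmf.expectation ?p (\<lambda>\<xi>. sqrt (H \<xi>)) + 30 * (L * D\<^sup>2 + D * G)"
    by (subst Bochner_Integration.integral_add)
       (auto intro: integrable_measure_pmf_finite fin)
  also have "\<dots> \<le> 9 * D * sqrt E + 30 * (L * D\<^sup>2 + D * G)"
    unfolding E_def using \<open>D > 0\<close>
    by (intro add_right_mono mult_left_mono expectation_sqrt_le fin)
       (auto simp: H_def intro!: sum_nonneg)
  also have "\<dots> \<le> 9 * D * (2 * ?\<sigma> * sqrt (ln (exp 1 * (?\<tau> / ?\<sigma>)) * real T)) + 30 * (L * D\<^sup>2 + D * G)"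
    using E \<open>D > 0\<close> by (intro add_right_mono mult_left_mono) auto
  finally show ?thesis by (simp add: mult_ac)
qed

theorem corollary10:
  "\<exists>C>0. \<forall>(d::nat) (X :: (nat \<Rightarrow>\<^sub>0 real) set) (D::real) (L::real) (G::real) (T::nat)
      (f :: nat \<Rightarrow> (nat \<Rightarrow>\<^sub>0 real) \<Rightarrow> real) (grad :: nat \<Rightarrow> (nat \<Rightarrow>\<^sub>0 real) \<Rightarrow> (nat \<Rightarrow>\<^sub>0 real))
      (A :: nat list \<Rightarrow> (nat \<Rightarrow>\<^sub>0 real)) (u :: nat \<Rightarrow>\<^sub>0 real).
     X \<subseteq> Rd d \<longrightarrow> closed X \<longrightarrow> bounded X \<longrightarrow> convex X \<longrightarrow>
     D > 0 \<longrightarrow> (\<forall>x\<in>X. \<forall>y\<in>X. norm (x - y) \<le> D) \<longrightarrow> (\<forall>x\<in>X. norm x \<le> D) \<longrightarrow>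
     T \<ge> 1 \<longrightarrow>
     (\<forall>k\<in>{1..T}. convex_on X (f k)) \<longrightarrow>
     (\<forall>k\<in>{1..T}. has_gradient_on (f k) (grad k) X \<and> grad k ` X \<subseteq> Rd d) \<longrightarrow>
     (\<forall>k\<in>{1..T}. L-lipschitz_on X (grad k)) \<longrightarrow>
     (\<forall>k\<in>{1..T}. \<forall>x\<in>X. norm (grad k x) \<le> G) \<longrightarrow>
     oftrl_learner X T D (L * D\<^sup>2 + D * G) grad A \<longrightarrow>
     u \<in> X \<longrightarrow>
     measure_pmf.expectation (random_order T)
         (\<lambda>\<xi>. regret T (observed_gradient grad A \<xi>) (decision A \<xi>) u)
       \<le> C * (D * sigma1 X T grad
                * sqrt (ln (exp 1 * (sigma1_tilde X T grad / sigma1 X T grad)) * real T)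
              + L * D\<^sup>2 + D * G)"
\<comment> \<open>30 is the larger of the constants 18 and 30; raising 18 to 30 requires the
  variance term to be nonnegative.\<close>
proof (intro exI[of _ 30] conjI allI impI)
  fix d :: nat and X :: "(nat \<Rightarrow>\<^sub>0 real) set" and D L G :: real and T :: nat
    and f :: "nat \<Rightarrow> (nat \<Rightarrow>\<^sub>0 real) \<Rightarrow> real" and grad :: "nat \<Rightarrow> (nat \<Rightarrow>\<^sub>0 real) \<Rightarrow> (nat \<Rightarrow>\<^sub>0 real)"
    and A :: "nat list \<Rightarrow> (nat \<Rightarrow>\<^sub>0 real)" and u :: "nat \<Rightarrow>\<^sub>0 real"
  assume "convex X" "D > 0" and diam: "\<forall>x\<in>X. \<forall>y\<in>X. norm (x - y) \<le> D" and rad: "\<forall>x\<in>X. norm x \<le> D"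
    and T: "T \<ge> 1"
    and lip: "\<forall>k\<in>{1..T}. L-lipschitz_on X (grad k)" and grad: "\<forall>k\<in>{1..T}. \<forall>x\<in>X. norm (grad k x) \<le> G"
    and learner: "oftrl_learner X T D (L * D\<^sup>2 + D * G) grad A" and "u \<in> X"
  interpret bounded_gradients X T grad G
    using T grad \<open>u \<in> X\<close> by unfold_locales auto
  let ?s = "sigma1 X T grad" and ?t = "sigma1_tilde X T grad"
  let ?B = "D * ?s * sqrt (ln (exp 1 * (?t / ?s)) * real T)"
  note s = sigma1_nonneg sigma1_le_sigma1_tilde
  \<comment> \<open>If \<open>sigma1\<close> is 0, the factor in front of the root makes the term 0,
    as the convention demands. Otherwise the ratio is at least 1 and the logarithm is
    nonnegative.\<close>
  have "0 \<le> ?B"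
  proof (cases "?s = 0")
    case False
    then have "1 \<le> ?t / ?s" using s by simp
    then have "1 \<le> exp 1 * (?t / ?s)" using mult_mono[of 1 "exp 1" 1 "?t / ?s"] by simp
    then show ?thesis using s \<open>D > 0\<close> by simp
  qed simp
  moreover have "measure_pmf.expectation (random_order T)
         (\<lambda>\<xi>. regret T (observed_gradient grad A \<xi>) (decision A \<xi>) u)
       \<le> 18 * ?B + 30 * (L * D\<^sup>2 + D * G)"
    using diam rad lip grad
    by (intro oftrl_expected_regret[OF \<open>convex X\<close> \<open>u \<in> X\<close> T \<open>D > 0\<close> _ _ _ _ learner]) blast+
  ultimately show "measure_pmf.expectation (random_order T)
         (\<lambda>\<xi>. regret T (observed_gradient grad A \<xi>) (decision A \<xi>) u)
       \<le> 30 * (?B + L * D\<^sup>2 + D * G)"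
    unfolding distrib_left[of 30] by linarith
qed simp

end
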